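(* Let $G$ be a simple graph. For every vertex $P \in V(G)$ we have $H_r(P) \subseteq H_f(P)$.
   Context: A graph is a finite connected multigraph with no loop edges; a simple graph is a graph with no multiple edges and more than one vertex. $\mathbb{N}=\{0,1,2,\dots\}$. A divisor on $G$ is a formal integer combination $D=\sum_{Q\in V(G)} D(Q)\,Q$; $\deg D=\sum_Q D(Q)$; $D\ge D'$ means $D(Q)\ge D'(Q)$ for all $Q$; $D$ is effective if $D\ge 0$. Let $\mathcal{M}(G)$ be the set of functions $V(G)\to\mathbb{Z}$. The Laplacian of $f\in\mathcal{M}(G)$ is the divisor $\Delta f$ with $\Delta f(Q)=\sum_{e=QR\in E(G)}(f(Q)-f(R))$ (sum over edges incident to $Q$, counted with multiplicity). Divisors $D,D'$ are linearly equivalent if $D-D'=\Delta f$ for some $f$. For a divisor $D$, $|D|=\{E\ge 0: E\sim D\}$. The rank $r(D)$ is $-1$ if $|D|=\emptyset$, and otherwise the largest $k\in\mathbb{N}$ such that $|D-E|\neq\emptyset$ for every effective divisor $E$ of degree $k$. For $P\in V(G)$: the rank Weierstrass set is $H_r(P)=\{n\in\mathbb{N}: r(nP)>r((n-1)P)\}$, and the functional Weierstrass set is $H_f(P)=\{n\in\mathbb{N}:\exists f\in\mathcal{M}(G)\text{ with }\Delta f(P)=-n\text{ and }\Delta f(Q)\ge 0\ \forall Q\neq P\}$ (i.e. $f$ has a unique pole, of order $n$, at $P$). *)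

theory Defs
  imports Main "HOL-Library.Multiset"
begin

text \<open>
  An edge is its two-element set of endpoints, and the edges form a multiset, so
  \<open>count E {u, v}\<close> is the number of parallel edges joining \<open>u\<close> and \<open>v\<close>.
\<close>

locale multigraph =
  fixes V :: "'v set" and E :: "'v set multiset"
  assumes finite_verts: "finite V"
    and verts_nonempty: "V \<noteq> {}"
    and edges: "\<And>e. e \<in># E \<Longrightarrow> e \<subseteq> V \<and> card e = 2"
    and connected: "\<And>u v. u \<in> V \<Longrightarrow> v \<in> V \<Longrightarrow> (u, v) \<in> {(x, y). {x, y} \<in># E}\<^sup>*"

locale simple_graph = multigraph V E for V :: "'v set" and E :: "'v set multiset" +
  assumes no_multiple_edges: "\<And>e. count E e \<le> 1"
    and more_than_one_vertex: "1 < card V"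

text \<open>Divisors are integer functions on the vertex type that vanish off \<open>V\<close>.\<close>

definition divisor :: "'v set \<Rightarrow> ('v \<Rightarrow> int) \<Rightarrow> bool" where
  "divisor V D \<longleftrightarrow> (\<forall>Q. Q \<notin> V \<longrightarrow> D Q = 0)"

definition deg :: "'v set \<Rightarrow> ('v \<Rightarrow> int) \<Rightarrow> int" where
  "deg V D = (\<Sum>Q\<in>V. D Q)"

definition effective :: "'v set \<Rightarrow> ('v \<Rightarrow> int) \<Rightarrow> bool" where
  "effective V D \<longleftrightarrow> divisor V D \<and> (\<forall>Q\<in>V. 0 \<le> D Q)"

text \<open>
  The outer sum runs over the edges at \<open>Q\<close> with multiplicity; the inner one has a single
  term, the other endpoint \<open>R\<close> of \<open>e\<close>. Since edges are subsets of \<open>V\<close>, values of \<open>f\<close> off \<open>V\<close>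
  do not affect the Laplacian on \<open>V\<close>, and the Laplacian vanishes off \<open>V\<close>. Hence total functions
  can stand for functions on \<open>V\<close>.
\<close>

definition laplacian :: "'v set multiset \<Rightarrow> ('v \<Rightarrow> int) \<Rightarrow> 'v \<Rightarrow> int" where
  "laplacian E f Q = (\<Sum>e\<in>#{#e \<in># E. Q \<in> e#}. \<Sum>R\<in>e - {Q}. f Q - f R)"

definition lin_equiv :: "'v set multiset \<Rightarrow> ('v \<Rightarrow> int) \<Rightarrow> ('v \<Rightarrow> int) \<Rightarrow> bool" where
  "lin_equiv E D D' \<longleftrightarrow> (\<exists>f. \<forall>Q. D Q - D' Q = laplacian E f Q)"

definition linear_system :: "'v set \<Rightarrow> 'v set multiset \<Rightarrow> ('v \<Rightarrow> int) \<Rightarrow> ('v \<Rightarrow> int) set" where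
  "linear_system V E D = {F. effective V F \<and> lin_equiv E F D}"

text \<open>
  On a multigraph the greatest \<open>k\<close> below exists when the linear system is nonempty:
  \<open>k = 0\<close> qualifies, and no \<open>k\<close> exceeding the degree of \<open>D\<close> does.
\<close>

definition rank :: "'v set \<Rightarrow> 'v set multiset \<Rightarrow> ('v \<Rightarrow> int) \<Rightarrow> int" where
  "rank V E D =
    (if linear_system V E D = {} then - 1
     else int (GREATEST k::nat. \<forall>F. effective V F \<and> deg V F = int k
                 \<longrightarrow> linear_system V E (\<lambda>Q. D Q - F Q) \<noteq> {}))"

definition multiple_of_point :: "int \<Rightarrow> 'v \<Rightarrow> 'v \<Rightarrow> int" where
  "multiple_of_point n P Q = (if Q = P then n else 0)"

definition rank_weierstrass_set :: "'v set \<Rightarrow> 'v set multiset \<Rightarrow> 'v \<Rightarrow> nat set" where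
  "rank_weierstrass_set V E P =
    {n. rank V E (multiple_of_point (int n) P) > rank V E (multiple_of_point (int n - 1) P)}"

definition functional_weierstrass_set :: "'v set \<Rightarrow> 'v set multiset \<Rightarrow> 'v \<Rightarrow> nat set" where
  "functional_weierstrass_set V E P =
    {n. \<exists>f. laplacian E f P = - int n \<and> (\<forall>Q\<in>V - {P}. 0 \<le> laplacian E f Q)}"

end

theory Submission
  imports Defs
begin

text \<open>
  The key is that in a simple graph a vertex \<open>P\<close> imposes no condition on linear systems beyond
  those imposed by its neighbours: if \<open>|D - Q|\<close> is nonempty for every neighbour \<open>Q\<close> of \<open>P\<close>, so
  is \<open>|D - P|\<close>. To see this, take \<open>f\<^sub>Q\<close> with \<open>D + \<Delta>f\<^sub>Q \<ge> Q\<close>, normalise \<open>f\<^sub>Q(P) = 0\<close>, and let \<open>g\<close> be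
  the pointwise minimum. Then \<open>D + \<Delta>g\<close> is effective. If it vanishes at \<open>P\<close>, all \<open>f\<^sub>Q\<close> agree with
  \<open>g\<close> on the neighbours of \<open>P\<close>, so \<open>D + \<Delta>g\<close> is positive at every neighbour, and each neighbour can
  send one chip along its single edge to \<open>P\<close>.

  Consequently the rank may be tested on effective divisors \<open>F\<close> avoiding \<open>P\<close>. If \<open>n\<close> is not in the
  functional Weierstrass set, every member of \<open>|nP|\<close> contains \<open>P\<close>. So for such \<open>F\<close>, a member of
  \<open>|nP - F|\<close> contains \<open>P\<close>, and removing \<open>P\<close> from it gives a member of \<open>|(n-1)P - F|\<close>.
\<close>

section \<open>The Laplacian on a multigraph\<close>

context multigraph
begin

lemma laplacian_outside:
  assumes "Q \<notin> V"
  shows "laplacian E f Q = 0"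
proof -
  have "{#e \<in># E. Q \<in> e#} = {#}"
    using edges assms by (subst filter_mset_eq_mempty_iff) auto
  then show ?thesis by (simp only: laplacian_def) simp
qed

text \<open>Trades the sum over edges for one over vertices weighted by multiplicity, which makes
  symmetry and monotonicity visible. The term \<open>R = Q\<close> is harmless since
  \<open>f Q - f Q = 0\<close>.\<close>

lemma laplacian_eq_sum_vertices:
  assumes "Q \<in> V"
  shows "laplacian E f Q = (\<Sum>R\<in>V. int (count E {Q, R}) * (f Q - f R))"
proof -
  \<comment> \<open>Generalised to any multiset \<open>M\<close> of two-element subsets of
    \<open>V\<close>, because removing an edge may destroy connectedness.\<close>
  have "laplacian M f Q = (\<Sum>R\<in>V. int (count M {Q, R}) * (f Q - f R))"
    if "\<And>e. e \<in># M \<Longrightarrow> e \<subseteq> V \<and> card e = 2" for M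
    using that
  proof (induction M)
    case empty
    then show ?case by (simp add: laplacian_def)
  next
    case (add e M)
    have IH: "laplacian M f Q = (\<Sum>R\<in>V. int (count M {Q, R}) * (f Q - f R))"
      using add by simp
    have "(if Q \<in> e then \<Sum>R\<in>e - {Q}. f Q - f R else 0)
        = (\<Sum>R\<in>V. if {Q, R} = e then f Q - f R else 0)"
    proof (cases "Q \<in> e")
      case True
      obtain R where R: "e = {Q, R}" "R \<noteq> Q" "R \<in> V"
        using add.prems[of e] True by (auto simp: card_2_iff)
      have "(\<Sum>S\<in>V. if {Q, S} = e then f Q - f S else 0) = (\<Sum>S\<in>V. if S = R then f Q - f S else 0)"
        using R by (intro sum.cong) (auto simp: doubleton_eq_iff)
      moreover have "e - {Q} = {R}" using R by auto
      ultimately show ?thesis using R finite_verts by simp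
    next
      case False
      then have "{Q, R} \<noteq> e" for R by auto
      then show ?thesis using False by simp
    qed
    moreover have "(\<Sum>R\<in>V. int (count (add_mset e M) {Q, R}) * (f Q - f R))
        = (\<Sum>R\<in>V. int (count M {Q, R}) * (f Q - f R))
          + (\<Sum>R\<in>V. if {Q, R} = e then f Q - f R else 0)"
      by (subst sum.distrib[symmetric], rule sum.cong) (auto simp: algebra_simps)
    moreover have "laplacian (add_mset e M) f Q
        = laplacian M f Q + (if Q \<in> e then \<Sum>R\<in>e - {Q}. f Q - f R else 0)"
      by (simp add: laplacian_def)
    ultimately show ?case using IH by simp
  qed
  then show ?thesis using edges by blast
qed

lemma laplacian_diff_const: "laplacian E (\<lambda>v. f v - c) Q = laplacian E f Q"
  by (simp add: laplacian_def)

lemma laplacian_add: "laplacian E (\<lambda>v. f v + g v) Q = laplacian E f Q + laplacian E g Q"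
  by (cases "Q \<in> V")
    (simp_all add: laplacian_outside laplacian_eq_sum_vertices sum.distrib[symmetric] algebra_simps)

lemma laplacian_antimono:
  assumes "Q \<in> V" and "g Q = f Q" and "\<And>v. v \<in> V \<Longrightarrow> g v \<le> f v"
  shows "laplacian E f Q \<le> laplacian E g Q"
  unfolding laplacian_eq_sum_vertices[OF assms(1)]
  using assms by (intro sum_mono mult_left_mono) auto

text \<open>Each edge contributes opposite amounts at its two ends, so swapping the summation
  indices negates the double sum.\<close>

lemma deg_laplacian: "deg V (laplacian E f) = 0"
proof -
  let ?S = "\<Sum>Q\<in>V. \<Sum>R\<in>V. int (count E {Q, R}) * (f Q - f R)"
  have "?S = (\<Sum>R\<in>V. \<Sum>Q\<in>V. int (count E {Q, R}) * (f Q - f R))"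
    by (rule sum.swap)
  also have "\<dots> = - ?S"
    unfolding sum_negf[symmetric]
    by (intro sum.cong refl) (simp add: insert_commute algebra_simps)
  finally have "?S = 0" by simp
  then show ?thesis by (simp add: deg_def laplacian_eq_sum_vertices)
qed

section \<open>Linear systems and the rank\<close>

lemma linear_system_nonempty_iff:
  assumes "divisor V D"
  shows "linear_system V E D \<noteq> {} \<longleftrightarrow> (\<exists>f. \<forall>Q\<in>V. 0 \<le> D Q + laplacian E f Q)"
proof
  assume "linear_system V E D \<noteq> {}"
  then obtain F f where F: "effective V F" "\<And>Q. F Q - D Q = laplacian E f Q"
    by (auto simp: linear_system_def lin_equiv_def)
  then have "0 \<le> D Q + laplacian E f Q" if "Q \<in> V" for Q
    using that by (simp add: effective_def flip: F(2))
  then show "\<exists>f. \<forall>Q\<in>V. 0 \<le> D Q + laplacian E f Q" by blast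
next
  assume "\<exists>f. \<forall>Q\<in>V. 0 \<le> D Q + laplacian E f Q"
  then obtain f where "\<forall>Q\<in>V. 0 \<le> D Q + laplacian E f Q" by blast
  then have "(\<lambda>Q. D Q + laplacian E f Q) \<in> linear_system V E D"
    using assms
    by (auto simp: linear_system_def lin_equiv_def effective_def divisor_def laplacian_outside)
  then show "linear_system V E D \<noteq> {}" by blast
qed

lemma deg_nonneg_if_linear_system_nonempty:
  assumes "divisor V D" and "linear_system V E D \<noteq> {}"
  shows "0 \<le> deg V D"
proof -
  obtain f where "\<forall>Q\<in>V. 0 \<le> D Q + laplacian E f Q"
    using assms linear_system_nonempty_iff by blast
  then have "0 \<le> (\<Sum>Q\<in>V. D Q + laplacian E f Q)" by (simp add: sum_nonneg)
  then show ?thesis using deg_laplacian by (simp add: deg_def sum.distrib)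
qed

lemma divisor_multiple_of_point: "P \<in> V \<Longrightarrow> divisor V (multiple_of_point c P)"
  by (auto simp: divisor_def multiple_of_point_def)

lemma deg_multiple_of_point: "P \<in> V \<Longrightarrow> deg V (multiple_of_point c P) = c"
  using finite_verts by (simp add: deg_def multiple_of_point_def)

text \<open>Frees later arguments from \<open>GREATEST\<close> and the default -1: the tested
  property is bounded by the degree and downward closed in \<open>k\<close>, so its greatest value
  decides it.\<close>

lemma le_rank_iff:
  assumes "divisor V D"
  shows "int k \<le> rank V E D \<longleftrightarrow>
    (\<forall>F. effective V F \<and> deg V F = int k \<longrightarrow> linear_system V E (\<lambda>Q. D Q - F Q) \<noteq> {})"
proof -
  define A where "A k \<longleftrightarrow> (\<forall>F. effective V F \<and> deg V F = int k
    \<longrightarrow> linear_system V E (\<lambda>Q. D Q - F Q) \<noteq> {})" for k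
  obtain P where P: "P \<in> V" using verts_nonempty by blast
  have bound: "k \<le> nat (deg V D)" if "A k" for k
  proof -
    let ?F = "multiple_of_point (int k) P"
    have "effective V ?F" using P by (auto simp: effective_def divisor_def multiple_of_point_def)
    then have "linear_system V E (\<lambda>Q. D Q - ?F Q) \<noteq> {}"
      using that P by (simp add: A_def deg_multiple_of_point)
    then have "0 \<le> deg V (\<lambda>Q. D Q - ?F Q)"
      using assms P divisor_multiple_of_point[OF P]
      by (intro deg_nonneg_if_linear_system_nonempty) (auto simp: divisor_def)
    also have "\<dots> = deg V D - int k"
      using deg_multiple_of_point[OF P, of "int k"] by (simp add: deg_def sum_subtractf)
    finally show ?thesis by simp
  qed
  have mono: "A j" if "A k" "j \<le> k" for j k
    unfolding A_def
  proof (intro allI impI)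
    fix F assume F: "effective V F \<and> deg V F = int j"
    \<comment> \<open>Pads \<open>F\<close> with chips at \<open>P\<close> up to degree
      \<open>k\<close>; subtracting less afterwards keeps the system nonempty.\<close>
    let ?M = "multiple_of_point (int (k - j)) P"
    have "effective V (\<lambda>Q. F Q + ?M Q)"
      using F P by (auto simp: effective_def divisor_def multiple_of_point_def)
    moreover have "deg V (\<lambda>Q. F Q + ?M Q) = int k"
      using F that(2) deg_multiple_of_point[OF P, of "int (k - j)"] by (simp add: deg_def sum.distrib)
    ultimately have "linear_system V E (\<lambda>Q. D Q - (F Q + ?M Q)) \<noteq> {}"
      using that(1) by (simp add: A_def)
    moreover have "divisor V (\<lambda>Q. D Q - (F Q + ?M Q))" "divisor V (\<lambda>Q. D Q - F Q)"
      using assms F P by (auto simp: effective_def divisor_def multiple_of_point_def)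
    moreover have "D Q - (F Q + ?M Q) \<le> D Q - F Q" for Q
      by (simp add: multiple_of_point_def)
    ultimately show "linear_system V E (\<lambda>Q. D Q - F Q) \<noteq> {}"
      by (simp only: linear_system_nonempty_iff) (meson add_right_mono order_trans)
  qed
  \<comment> \<open>The only effective divisor of degree 0 is zero, so the default -1 occurs exactly
    when \<open>A\<close> fails at 0.\<close>
  have zero: "A 0 \<longleftrightarrow> linear_system V E D \<noteq> {}"
  proof -
    have "F = (\<lambda>_. 0)" if F: "effective V F" "deg V F = 0" for F
    proof
      fix Q
      have "\<forall>Q\<in>V. F Q = 0"
        using F finite_verts by (simp add: effective_def deg_def sum_nonneg_eq_0_iff)
      then show "F Q = 0" using F(1) by (cases "Q \<in> V") (auto simp: effective_def divisor_def)
    qed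
    then have "effective V F \<and> deg V F = 0 \<longleftrightarrow> F = (\<lambda>_. 0)" for F
      by (auto simp: effective_def divisor_def deg_def)
    then show ?thesis by (simp add: A_def)
  qed
  have "int k \<le> rank V E D \<longleftrightarrow> A k"
  proof (cases "A 0")
    case True
    then have "rank V E D = int (GREATEST k. A k)"
      using zero by (simp add: rank_def A_def)
    moreover have "A (GREATEST k. A k)" using GreatestI_nat[of A, OF True] bound by blast
    moreover have "k \<le> (GREATEST k. A k)" if "A k"
      using Greatest_le_nat[of A, OF that] bound by blast
    ultimately show ?thesis using mono[of "GREATEST k. A k" k] by auto
  next
    case False
    then show ?thesis using zero mono[of k 0] by (auto simp: rank_def)
  qed
  then show ?thesis by (simp add: A_def)
qed

end

section \<open>Simple graphs: trading a vertex for its neighbours\<close>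

context simple_graph
begin

lemma ex_neighbour:
  assumes "P \<in> V"
  shows "\<exists>Q. {P, Q} \<in># E"
proof -
  have "\<not> V \<subseteq> {P}"
    using card_mono[of "{P}" V] more_than_one_vertex by auto
  then obtain v where "v \<in> V" "v \<noteq> P" by blast
  with connected[OF assms] have "(P, v) \<in> {(x, y). {x, y} \<in># E}\<^sup>*" by blast
  then show ?thesis using \<open>v \<noteq> P\<close> by (auto elim: converse_rtranclE)
qed

lemma linear_system_minus_vertex_nonempty:
  assumes D: "divisor V D" and P: "P \<in> V"
    and nb: "\<And>Q. {P, Q} \<in># E \<Longrightarrow> linear_system V E (\<lambda>R. D R - multiple_of_point 1 Q R) \<noteq> {}"
  shows "linear_system V E (\<lambda>R. D R - multiple_of_point 1 P R) \<noteq> {}"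
proof -
  define N where "N = {Q. {P, Q} \<in># E}"
  have N: "Q \<in> V" "Q \<noteq> P" "count E {P, Q} = 1" if "Q \<in> N" for Q
  proof -
    have e: "{P, Q} \<in># E" using that by (simp add: N_def)
    show "Q \<in> V" using edges[OF e] by simp
    show "Q \<noteq> P" using edges[OF e] by auto
    show "count E {P, Q} = 1" using no_multiple_edges[of "{P, Q}"] e
      by (metis count_greater_eq_one_iff le_antisym)
  qed
  have N_iff: "count E {P, Q} = (if Q \<in> N then 1 else 0)" for Q
    using N by (auto simp: N_def not_in_iff)
  have "N \<subseteq> V" using N by blast
  then have finN: "finite N" using finite_verts finite_subset by blast
  have neN: "N \<noteq> {}" using ex_neighbour[OF P] by (auto simp: N_def)
  have "\<exists>f. f P = 0 \<and> (\<forall>R\<in>V. 0 \<le> D R - multiple_of_point 1 Q R + laplacian E f R)"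
    if Q: "Q \<in> N" for Q
  proof -
    have "divisor V (\<lambda>R. D R - multiple_of_point 1 Q R)"
      using D N(1)[OF Q] by (auto simp: divisor_def multiple_of_point_def)
    then obtain f where "\<forall>R\<in>V. 0 \<le> D R - multiple_of_point 1 Q R + laplacian E f R"
      using nb[of Q] Q by (auto simp: N_def linear_system_nonempty_iff)
    then show ?thesis
      by (intro exI[of _ "\<lambda>v. f v - f P"]) (simp add: laplacian_diff_const)
  qed
  then obtain f where f0: "\<And>Q. Q \<in> N \<Longrightarrow> f Q P = 0"
    and f: "\<And>Q R. Q \<in> N \<Longrightarrow> R \<in> V \<Longrightarrow> 0 \<le> D R - multiple_of_point 1 Q R + laplacian E (f Q) R"
    by metis
  define g where "g v = Min ((\<lambda>Q. f Q v) ` N)" for v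
  have g_le: "g v \<le> f Q v" if "Q \<in> N" for Q v
    using finN that by (simp add: g_def)
  have g_ex: "\<exists>Q\<in>N. g v = f Q v" for v
  proof -
    have "Min ((\<lambda>Q. f Q v) ` N) \<in> (\<lambda>Q. f Q v) ` N"
      using finN neN by (intro Min_in) auto
    then show ?thesis by (auto simp only: g_def)
  qed
  have gP: "g P = 0" using g_ex[of P] f0 by auto
  have g_eff: "0 \<le> D R + laplacian E g R" if "R \<in> V" for R
  proof -
    obtain Q where Q: "Q \<in> N" "g R = f Q R" using g_ex by blast
    have "laplacian E (f Q) R \<le> laplacian E g R"
      using that Q g_le by (intro laplacian_antimono) auto
    then show ?thesis using f[OF Q(1) that] by (simp add: multiple_of_point_def split: if_splits)
  qed
  have div: "divisor V (\<lambda>R. D R - multiple_of_point 1 P R)"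
    using D P by (auto simp: divisor_def multiple_of_point_def)
  show ?thesis
  proof (cases "1 \<le> D P + laplacian E g P")
    case True
    then have "\<forall>R\<in>V. 0 \<le> D R - multiple_of_point 1 P R + laplacian E g R"
      using g_eff by (auto simp: multiple_of_point_def)
    then show ?thesis using linear_system_nonempty_iff[OF div] by blast
  next
    case False
    \<comment> \<open>Single edges make every neighbour count once.\<close>
    have lapP: "laplacian E h P = - (\<Sum>R\<in>N. h R)" if "h P = 0" for h
    proof -
      have "laplacian E h P = (\<Sum>R\<in>V. if R \<in> N then - h R else 0)"
        unfolding laplacian_eq_sum_vertices[OF P] using that
        by (intro sum.cong) (auto simp: N_iff)
      also have "\<dots> = - (\<Sum>R\<in>N. h R)"
        using \<open>N \<subseteq> V\<close> finite_verts by (simp add: sum.inter_restrict[symmetric] Int_absorb1 sum_negf)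
      finally show ?thesis .
    qed
    \<comment> \<open>Squeeze: the failed case gives \<open>D P\<close> \<le> sum of
      \<open>g\<close> over \<open>N\<close>, while \<open>f Q\<close> gives sum of
      \<open>f Q\<close> \<le> \<open>D P\<close>. As \<open>g\<close> \<le> \<open>f Q\<close>
      termwise, all terms agree.\<close>
    have g_eq: "g R = f Q R" if "Q \<in> N" "R \<in> N" for Q R
    proof -
      have "(\<Sum>R\<in>N. g R) \<le> (\<Sum>R\<in>N. f Q R)"
        using g_le that by (intro sum_mono) auto
      moreover have "0 \<le> D P + laplacian E (f Q) P"
        using f[OF that(1) P] N(2)[OF that(1)] by (simp add: multiple_of_point_def)
      ultimately have "(\<Sum>R\<in>N. g R) = (\<Sum>R\<in>N. f Q R)"
        using False lapP[of g, OF gP] lapP[of "f Q", OF f0[OF that(1)]] by simp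
      then have "(\<Sum>R\<in>N. f Q R - g R) = 0" by (simp add: sum_subtractf)
      then have "\<forall>R\<in>N. f Q R - g R = 0"
        using g_le that finN by (subst (asm) sum_nonneg_eq_0_iff) auto
      then show ?thesis using that by simp
    qed
    have pos: "1 \<le> D Q + laplacian E g Q" if "Q \<in> N" for Q
    proof -
      have "laplacian E (f Q) Q \<le> laplacian E g Q"
        using that N(1) g_le g_eq by (intro laplacian_antimono) auto
      then show ?thesis using f[OF that N(1)[OF that]] by (simp add: multiple_of_point_def)
    qed
    \<comment> \<open>The indicator function of \<open>P\<close> minus 1: adding its Laplacian moves
      one chip from each neighbour to \<open>P\<close>.\<close>
    let ?c = "\<lambda>v. if v = P then 0 else - 1 :: int"
    have cP: "laplacian E ?c P \<ge> 1"
    proof -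
      have "laplacian E ?c P = (\<Sum>R\<in>N. 1)"
        using N(2) by (subst lapP) (auto simp flip: sum_negf intro!: sum.cong)
      also have "\<dots> = int (card N)" by simp
      finally show ?thesis using finN neN card_gt_0_iff[of N] by linarith
    qed
    have cR: "laplacian E ?c R = (if R \<in> N then - 1 else 0)" if "R \<in> V" "R \<noteq> P" for R
    proof -
      have "laplacian E ?c R = (\<Sum>S\<in>V. if S = P then - int (count E {R, P}) else 0)"
        unfolding laplacian_eq_sum_vertices[OF that(1)] using that
        by (intro sum.cong) auto
      also have "\<dots> = - int (count E {R, P})"
        using finite_verts P by simp
      finally show ?thesis using N_iff[of R] by (simp add: insert_commute)
    qed
    have "0 \<le> D R - multiple_of_point 1 P R + laplacian E (\<lambda>v. g v + ?c v) R" if "R \<in> V" for R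
      unfolding laplacian_add
      using g_eff[OF that] pos[of R] cP cR[OF that]
      by (cases "R = P") (auto simp: multiple_of_point_def)
    then show ?thesis using linear_system_nonempty_iff[OF div] by blast
  qed
qed

text \<open>Induction on \<open>F P\<close>: moving one chip of \<open>F\<close> from
  \<open>P\<close> to a neighbour keeps the degree and lowers \<open>F P\<close>, and the previous
  lemma recovers \<open>F\<close> from all these moves.\<close>

lemma rank_determined_off_vertex:
  assumes D: "divisor V D" and P: "P \<in> V"
    and off: "\<And>F. effective V F \<Longrightarrow> deg V F = d \<Longrightarrow> F P = 0
      \<Longrightarrow> linear_system V E (\<lambda>Q. D Q - F Q) \<noteq> {}"
    and F: "effective V F" "deg V F = d"
  shows "linear_system V E (\<lambda>Q. D Q - F Q) \<noteq> {}"
  using F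
proof (induction "nat (F P)" arbitrary: F)
  case 0
  then have "F P = 0" using P by (auto simp: effective_def intro: antisym)
  then show ?case using off 0 by blast
next
  case (Suc a)
  let ?F = "\<lambda>Q. F Q - multiple_of_point 1 P Q"
  have "linear_system V E (\<lambda>R. (D R - ?F R) - multiple_of_point 1 P R) \<noteq> {}"
  proof (rule linear_system_minus_vertex_nonempty[OF _ P])
    show "divisor V (\<lambda>R. D R - ?F R)"
      using D P Suc.prems by (auto simp: effective_def divisor_def multiple_of_point_def)
  next
    fix Q assume Q: "{P, Q} \<in># E"
    have QV: "Q \<in> V" "Q \<noteq> P" using edges[OF Q] by auto
    let ?G = "\<lambda>R. ?F R + multiple_of_point 1 Q R"
    have "effective V ?G"
      using Suc.prems Suc.hyps(2) P QV by (auto simp: effective_def divisor_def multiple_of_point_def)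
    moreover have "deg V ?G = d"
      using Suc.prems(2) deg_multiple_of_point[OF P, of 1] deg_multiple_of_point[OF QV(1), of 1]
      by (simp add: deg_def sum.distrib sum_subtractf)
    moreover have "a = nat (?G P)"
      using Suc.hyps(2) QV by (simp add: multiple_of_point_def)
    ultimately have "linear_system V E (\<lambda>R. D R - ?G R) \<noteq> {}"
      by (intro Suc.hyps(1))
    then show "linear_system V E (\<lambda>R. (D R - ?F R) - multiple_of_point 1 Q R) \<noteq> {}"
      by (simp add: algebra_simps)
  qed
  then show ?case by simp
qed

section \<open>Comparing the two Weierstrass sets\<close>

lemma rank_weierstrass_subset_functional_weierstrass:
  assumes P: "P \<in> V"
  shows "rank_weierstrass_set V E P \<subseteq> functional_weierstrass_set V E P"
proof (rule subsetI, rule ccontr)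
  fix n
  let ?D = "multiple_of_point (int n) P" and ?D' = "multiple_of_point (int n - 1) P"
  assume "n \<in> rank_weierstrass_set V E P"
  then have less: "rank V E ?D' < rank V E ?D" by (simp add: rank_weierstrass_set_def)
  assume "n \<notin> functional_weierstrass_set V E P"
  then have nf: "\<not> (laplacian E f P = - int n \<and> (\<forall>Q\<in>V - {P}. 0 \<le> laplacian E f Q))" for f
    by (simp add: functional_weierstrass_set_def)
  have div: "divisor V ?D" "divisor V ?D'"
    using divisor_multiple_of_point[OF P] by auto
  \<comment> \<open>Since ranks start at -1, the strictly larger rank is a natural number
    \<open>k\<close>.\<close>
  have "-1 \<le> rank V E ?D'" by (simp add: rank_def)
  with less have "0 \<le> rank V E ?D" by linarith
  then obtain k where k: "rank V E ?D = int k" by (rule nonneg_int_cases)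
  then have r: "linear_system V E (\<lambda>Q. ?D Q - F Q) \<noteq> {}"
    if "effective V F" "deg V F = int k" for F
    using le_rank_iff[OF div(1), of k] that by simp
  have "linear_system V E (\<lambda>Q. ?D' Q - F Q) \<noteq> {}"
    if F: "effective V F" "deg V F = int k" and FP: "F P = 0" for F
  proof -
    have divF: "divisor V (\<lambda>Q. ?D Q - F Q)" "divisor V (\<lambda>Q. ?D' Q - F Q)"
      using div F(1) by (auto simp: divisor_def effective_def)
    obtain f where f: "\<And>Q. Q \<in> V \<Longrightarrow> 0 \<le> ?D Q - F Q + laplacian E f Q"
      using r[OF F] linear_system_nonempty_iff[OF divF(1)] by blast
    have "0 \<le> laplacian E f Q" if "Q \<in> V - {P}" for Q
    proof -
      have "0 \<le> F Q" using F(1) that by (simp add: effective_def)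
      then show ?thesis using f[of Q] that by (simp add: multiple_of_point_def)
    qed
    \<comment> \<open>As \<open>F P = 0\<close>, the Laplacian at \<open>P\<close> is at least
      \<open>- int n\<close>; excluding equality gains the one chip separating \<open>?D\<close>
      from \<open>?D'\<close>.\<close>
    then have "laplacian E f P \<noteq> - int n" using nf by blast
    then have "0 \<le> ?D' P - F P + laplacian E f P"
      using f[OF P] FP by (simp add: multiple_of_point_def)
    then have "\<forall>Q\<in>V. 0 \<le> ?D' Q - F Q + laplacian E f Q"
      using f by (metis multiple_of_point_def)
    then show ?thesis using linear_system_nonempty_iff[OF divF(2)] by blast
  qed
  then have "int k \<le> rank V E ?D'"
    using rank_determined_off_vertex[OF div(2) P] le_rank_iff[OF div(2)] by blast
  then show False using less k by simp
qed

end

theorem theoremA: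
  fixes V :: "'v set" and E :: "'v set multiset" and P :: 'v
  assumes "simple_graph V E"
    and "P \<in> V"
  shows "rank_weierstrass_set V E P \<subseteq> functional_weierstrass_set V E P"
  using assms by (rule simple_graph.rank_weierstrass_subset_functional_weierstrass)

end
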